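(* Consider, on a Voronoi grid with dual Delaunay triangles $\omega_p$, the semi-discrete thermal impulse equation without source terms $$\frac{\mathrm{d}\mathbf{j}_p}{\mathrm{d}t}=-\frac{1}{|\omega_p|}\sum_{c\in\mathcal{C}(p)} l_{cp}\mathbf{n}_{cp}\,\varphi_c-\frac{1}{|\omega_p|}\sum_{c\in\mathcal{C}(p)}|\omega_{cp}|\,\mathbb{C}_c(\mathbf{j}_p)\times\mathbf{u}_c ,$$ with initial data given by the discrete gradient of a scalar potential, $\mathbf{j}_p=\mathbb{G}_p(\phi_c)$ at $t=0$. Define the discrete curl on the dual cell $\omega_p$ by $$\mathbb{C}_p(\mathbf{j}_p):=\frac{1}{|\omega_p|}\sum_{c\in\mathcal{C}(p)}|\omega_{cp}|\,\mathbb{C}_c(\mathbf{j}_p).$$ Then the scheme satisfies the curl-free involution in the sense that $$\frac{\mathrm{d}}{\mathrm{d}t}\mathbb{C}_p(\mathbf{j}_p)=0 .$$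
   Context: Mesh. A two-dimensional domain $\Omega$ is partitioned into finitely many non-overlapping Voronoi cells $\omega_c$ with generators $\mathbf{x}_c$ and areas $|\omega_c|$; the grid is conforming. Every (interior) vertex $\mathbf{x}_p$ of a Voronoi cell is the circumcenter of a triangle $\omega_p$, of area $|\omega_p|$, whose corners are the three generators of the surrounding Voronoi cells (dual Delaunay triangulation). $\mathcal{P}(c)$ is the set of vertices of $\omega_c$; $\mathcal{C}(p)$ is the set of the three cells whose generators are the corners of $\omega_p$. The subcell $\omega_{cp}$, of area $|\omega_{cp}|$, is the part of $\omega_p$ obtained by connecting $\mathbf{x}_p$, $\mathbf{x}_c$ and the midpoints of the two edges of $\omega_p$ meeting at $\mathbf{x}_c$. Corner vectors. For $c\in\mathcal{C}(p)$ let $\mathbf{x}_{d^\pm}$ be the two other corners of $\omega_p$, $\mathbf{n}^{\pm}$ the unit normals, outward with respect to $\omega_p$, of the edges $\mathbf{x}_c\mathbf{x}_{d^\pm}$, and $l^{\pm}=\tfrac12\|\mathbf{x}_c-\mathbf{x}_{d^\pm}\|$. Set $l_{cp}\mathbf{n}_{cp}=l^-\mathbf{n}^-+l^+\mathbf{n}^+$ and $l_{cp}\mathbf{t}_{cp}=(-l_{cp}\mathbf{n}_{cp}\cdot\mathbf{e}_y,\ l_{cp}\mathbf{n}_{cp}\cdot\mathbf{e}_x)$. Discrete operators. For cell values $\phi_c$ and dual-cell vectors $\boldsymbol{\psi}_p$, $$\mathbb{G}_p(\phi_c)=\frac{1}{|\omega_p|}\sum_{c\in\mathcal{C}(p)}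 l_{cp}\mathbf{n}_{cp}\phi_c,\qquad \mathbb{C}_c(\boldsymbol{\psi}_p)=-\frac{1}{|\omega_c|}\sum_{p\in\mathcal{P}(c)} l_{cp}\mathbf{t}_{cp}\cdot\boldsymbol{\psi}_p .$$ The scalar $\mathbb{C}_c$ is identified with the vector $\mathbb{C}_c\,\mathbf{e}_z$, so that $\mathbb{C}_c\times\mathbf{u}_c=\mathbb{C}_c\,(-u_{2},u_{1})_c$. Data of the scheme. $\mathbf{j}_p(t)\in\mathbb{R}^2$ is the thermal impulse on the dual cells, $\mathbf{u}_c(t)\in\mathbb{R}^2$ and $\theta_c(t)$ are the velocity and temperature in the Voronoi cells, and $\varphi_c=\mathbf{j}_c\cdot\mathbf{u}_c+\theta_c$ is a scalar cell value. Here $\mathbf{j}_c$ solves the cell system $$\sum_{p\in\mathcal{P}(c)}\mathbf{M}_{cp}\,\mathbf{j}_c=\sum_{p\in\mathcal{P}(c)}\left(\mathbf{M}_{cp}\,\mathbf{j}_p+l_{cp}\mathbf{n}_{cp}\varphi_p\right),\qquad \mathbf{M}_{cp}=z_p\left(l_{cp}^-\,\mathbf{n}_{cp}^-\otimes\mathbf{n}_{cp}^-+l_{cp}^+\,\mathbf{n}_{cp}^+\otimes\mathbf{n}_{cp}^+\right),$$ with $l_{cp}^\pm=l^\pm=\tfrac12\|\mathbf{x}_c-\mathbf{x}_{d^\pm}\|$ the half-lengths, and $\mathbf{n}_{cp}^\pm=\mathbf{n}^\pm$ the unit normals, outward with respect to $\omega_p$, of the two edges $\mathbf{x}_c\mathbf{x}_{d^\pm}$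 of $\omega_p$ meeting at $\mathbf{x}_c$, $z_p>0$ the maximal absolute characteristic speed at $p$, and $\varphi_p$ the value of $\varphi=\mathbf{j}\cdot\mathbf{u}+\theta$ at node $p$. Boundary convention. If a cell $\omega_c$ has nodes on $\partial\Omega$, the boundary values of $\mathbf{j}$ are set at all times so that the full discrete curl $\mathbb{C}_c(\mathbf{j}_p)$ of that cell, including the boundary contribution, is zero (the normal component of $\mathbf{j}$ is prescribed and the tangential component is chosen to achieve this).
   Formalization: The cell velocities u_c(t) are assumed continuous in time on [0,T], which the statement leaves implicit; for velocities unbounded in time (such as u_c ~ 1/t near t=0) a nonzero curl can grow from zero initial data. *)

theory Defs
  imports "HOL-Analysis.Analysis"
begin

text \<open>
  Cells are named by their generators and nodes by their positions, so both are points of the plane.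
\<close>

type_synonym point = "real^2"

definition rot :: "point \<Rightarrow> point" where
  "rot v = vector [- (v $ 2), v $ 1]"

definition tensor :: "point \<Rightarrow> point \<Rightarrow> real^2^2" where
  "tensor v w = (\<chi> i k. v $ i * w $ k)"

text \<open>
  Unit normal of the edge from \<open>a\<close> to \<open>b\<close>, outward with respect to the set \<open>S\<close> having that edge.
\<close>

definition outward_normal :: "point set \<Rightarrow> point \<Rightarrow> point \<Rightarrow> point" where
  "outward_normal S a b =
     (THE n. norm n = 1 \<and> n \<bullet> (b - a) = 0 \<and> (\<forall>y\<in>S. n \<bullet> (y - a) \<le> 0))"

text \<open>
  A boundary node has no dual triangle from which the half-lengths and the normals of its corners
  could be read off. For a cell \<open>c\<close> and a node \<open>b\<close> on the boundary of the domain, the two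
  half-lengths \<open>l\<^sup>-\<close>, \<open>l\<^sup>+\<close> and the two unit normals \<open>n\<^sup>-\<close>, \<open>n\<^sup>+\<close> are therefore part of the data
  of the grid, with the sign given as a truth value.
\<close>

record voronoi_grid =
  domain :: "point set"
  generators :: "point set"
  bnodes :: "point set"
  bhalf_length :: "point \<Rightarrow> point \<Rightarrow> bool \<Rightarrow> real"
  bnormal :: "point \<Rightarrow> point \<Rightarrow> bool \<Rightarrow> point"

definition cell :: "voronoi_grid \<Rightarrow> point \<Rightarrow> point set" where
  "cell V c = {y \<in> closure (domain V). \<forall>d\<in>generators V. dist y c \<le> dist y d}"

definition cells_at :: "voronoi_grid \<Rightarrow> point \<Rightarrow> point set" where
  "cells_at V p = {c \<in> generators V. p \<in> cell V c}"

text \<open>The interior vertices: points of the (open) domain at which at least three cells meet.\<close>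

definition inodes :: "voronoi_grid \<Rightarrow> point set" where
  "inodes V = {p \<in> domain V. 3 \<le> card (cells_at V p)}"

text \<open>
  The grid is conforming: every node lying on a cell is a vertex of that cell.
\<close>

definition nodes_of :: "voronoi_grid \<Rightarrow> point \<Rightarrow> point set" where
  "nodes_of V c = (inodes V \<union> bnodes V) \<inter> cell V c"

text \<open>
  The cells cover the closed domain and do not overlap by construction, and an interior vertex is
  equidistant from the generators of the cells meeting there, hence the circumcenter of its dual
  triangle. The polygonal shape of the cells enters at the boundary only: a cell that reaches the
  boundary of the domain has a vertex there.
\<close>

definition is_voronoi_grid :: "voronoi_grid \<Rightarrow> bool" where
  "is_voronoi_grid V \<longleftrightarrow>
     open (domain V) \<and> connected (domain V) \<and> bounded (domain V) \<and>
     generators V \<noteq> {} \<and> finite (generators V) \<and> generators V \<subseteq> domain V \<and>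
     (\<forall>p\<in>inodes V. card (cells_at V p) = 3) \<and>
     finite (bnodes V) \<and> bnodes V \<subseteq> frontier (domain V) \<and>
     (\<forall>c\<in>generators V. cell V c \<inter> frontier (domain V) \<noteq> {} \<longrightarrow> cell V c \<inter> bnodes V \<noteq> {}) \<and>
     (\<forall>c\<in>generators V. \<forall>b\<in>bnodes V \<inter> cell V c. \<forall>s.
        0 \<le> bhalf_length V c b s \<and> norm (bnormal V c b s) = 1)"

definition dual_cell :: "voronoi_grid \<Rightarrow> point \<Rightarrow> point set" where
  "dual_cell V p = convex hull (cells_at V p)"

text \<open>
  If the circumcenter \<open>p\<close> belongs to the dual triangle, the quadrilateral below is contained in the
  triangle and the intersection is redundant.
\<close>

definition subcell :: "voronoi_grid \<Rightarrow> point \<Rightarrow> point \<Rightarrow> point set" where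
  "subcell V c p =
     dual_cell V p \<inter> convex hull ({p, c} \<union> (\<lambda>d. midpoint c d) ` (cells_at V p - {c}))"

definition area :: "point set \<Rightarrow> real" where
  "area S = measure lebesgue S"

text \<open>
  The vectors \<open>l\<^bsub>cp\<^esub> n\<^bsub>cp\<^esub>\<close> and \<open>l\<^bsub>cp\<^esub> t\<^bsub>cp\<^esub>\<close>. At an interior
  vertex the two edges of the dual triangle meeting at \<open>c\<close> are indexed by their other endpoint \<open>d\<close>.
\<close>

definition corner_normal :: "voronoi_grid \<Rightarrow> point \<Rightarrow> point \<Rightarrow> point" where
  "corner_normal V c p =
     (if p \<in> inodes V
      then \<Sum>d\<in>cells_at V p - {c}. (dist c d / 2) *\<^sub>R outward_normal (dual_cell V p) c d
      else \<Sum>s\<in>UNIV. bhalf_length V c p s *\<^sub>R bnormal V c p s)"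

definition corner_tangent :: "voronoi_grid \<Rightarrow> point \<Rightarrow> point \<Rightarrow> point" where
  "corner_tangent V c p = rot (corner_normal V c p)"

definition corner_matrix :: "voronoi_grid \<Rightarrow> real \<Rightarrow> point \<Rightarrow> point \<Rightarrow> real^2^2" where
  "corner_matrix V z c p =
     z *\<^sub>R (if p \<in> inodes V
            then \<Sum>d\<in>cells_at V p - {c}. (dist c d / 2) *\<^sub>R
                   tensor (outward_normal (dual_cell V p) c d) (outward_normal (dual_cell V p) c d)
            else \<Sum>s\<in>UNIV. bhalf_length V c p s *\<^sub>R tensor (bnormal V c p s) (bnormal V c p s))"

definition dgrad :: "voronoi_grid \<Rightarrow> (point \<Rightarrow> real) \<Rightarrow> point \<Rightarrow> point" where
  "dgrad V \<phi> p = (1 / area (dual_cell V p)) *\<^sub>R (\<Sum>c\<in>cells_at V p. \<phi> c *\<^sub>R corner_normal V c p)"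

definition dcurl :: "voronoi_grid \<Rightarrow> (point \<Rightarrow> point) \<Rightarrow> point \<Rightarrow> real" where
  "dcurl V \<psi> c = - (1 / area (cell V c)) * (\<Sum>p\<in>nodes_of V c. corner_tangent V c p \<bullet> \<psi> p)"

definition dual_dcurl :: "voronoi_grid \<Rightarrow> (point \<Rightarrow> point) \<Rightarrow> point \<Rightarrow> real" where
  "dual_dcurl V \<psi> p =
     (1 / area (dual_cell V p)) * (\<Sum>c\<in>cells_at V p. area (subcell V c p) * dcurl V \<psi> c)"

end

(*
  At an interior node p with corners c, d, e the number t_cp . n_dp / |w_p| is half the sign of the
  orientation of (c, d, e). A cell away from the boundary is a full convex Voronoi polygon, and the
  two ends of the edge it shares with a neighbour d carry opposite orientations, so the
  contributions of d cancel: the discrete curl of a discrete gradient vanishes on such cells. What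
  remains of the evolution is a linear homogeneous system with bounded coefficients for the cell
  curls, which vanish initially (and always at the boundary), hence for all times by Gronwall.
*)

theory Submission
  imports Defs
begin

section \<open>Quarter turns and orientation in the plane\<close>

lemma rot_nth [simp]: "rot v $ 1 = - (v $ 2)" "rot v $ 2 = v $ 1"
  by (simp_all add: rot_def)

lemma inner_real2: "(x :: real^2) \<bullet> y = x $ 1 * y $ 1 + x $ 2 * y $ 2"
  by (simp add: inner_vec_def UNIV_2)

lemma rot_self_inner [simp]: "rot v \<bullet> v = 0"
  by (simp add: inner_real2)

lemma norm_rot [simp]: "norm (rot v) = norm v"
  by (simp add: norm_eq_sqrt_inner inner_real2)

text \<open>The orthogonal complement of a nonzero plane vector is a line, spanned by its quarter
  turn; projecting \<open>w\<close> onto that line gives the coefficient.\<close>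

lemma orthogonal_eq_scaleR_rot:
  assumes "v \<noteq> 0" "w \<bullet> v = 0"
  obtains s where "w = s *\<^sub>R rot v"
proof
  have v: "v $ 1 ^ 2 + v $ 2 ^ 2 \<noteq> 0"
    using assms(1) by (auto simp: vec_eq_iff forall_2 sum_power2_eq_zero_iff)
  have w: "w $ 1 * v $ 1 + w $ 2 * v $ 2 = 0"
    using assms(2) by (simp add: inner_real2)
  have "w $ 1 * (v $ 1 ^ 2 + v $ 2 ^ 2) = (w \<bullet> rot v) * - v $ 2"
    "w $ 2 * (v $ 1 ^ 2 + v $ 2 ^ 2) = (w \<bullet> rot v) * v $ 1"
    using w unfolding inner_real2 rot_nth by algebra+
  with v show "w = ((w \<bullet> rot v) / (v $ 1 ^ 2 + v $ 2 ^ 2)) *\<^sub>R rot v"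
    by (simp add: vec_eq_iff forall_2 field_simps)
qed

text \<open>Twice the signed area of the triangle, positive if the corners run
  counterclockwise.\<close>

definition tri :: "point \<Rightarrow> point \<Rightarrow> point \<Rightarrow> real" where
  "tri a b c = rot (b - a) \<bullet> (c - a)"

lemma tri_swap: "tri a c b = - tri a b c" and tri_rotate: "tri b c a = tri a b c"
  by (simp_all add: tri_def inner_real2 algebra_simps)

lemma tri_nonzero_distinct:
  assumes "tri a b c \<noteq> 0"
  shows "a \<noteq> b" "a \<noteq> c" "b \<noteq> c"
  using assms by (auto simp: tri_def inner_real2 algebra_simps)

text \<open>A line meets a circle in at most two points, so three distinct points equidistant from
  \<open>p\<close> cannot be collinear.\<close>

lemma tri_circumcenter_nonzero:
  assumes "dist p a = dist p b" "dist p a = dist p c" "a \<noteq> b" "a \<noteq> c" "b \<noteq> c"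
  shows "tri a b c \<noteq> 0"
proof
  assume "tri a b c = 0"
  then have "(c - a) \<bullet> rot (b - a) = 0" by (simp add: tri_def inner_commute)
  moreover have "rot (b - a) \<noteq> 0"
    using assms(3) norm_rot[of "b - a"] by fastforce
  ultimately obtain s where s: "c - a = s *\<^sub>R rot (rot (b - a))"
    using orthogonal_eq_scaleR_rot by blast
  have "rot (rot (b - a)) = a - b" by (simp add: vec_eq_iff forall_2)
  with s have c: "c = a - s *\<^sub>R (b - a)"
    by (simp add: algebra_simps)
  have "(p - a) \<bullet> (p - a) = (p - x) \<bullet> (p - x)" if "dist p a = dist p x" for x
    using that by (simp add: dist_norm dot_square_norm)
  then have eqs: "(p - a) \<bullet> (p - a) = (p - b) \<bullet> (p - b)" "(p - a) \<bullet> (p - a) = (p - c) \<bullet> (p - c)"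
    using assms(1,2) by blast+
  \<comment> \<open>On the line through \<open>a\<close> and \<open>b\<close>, equidistance from
    \<open>p\<close> is a quadratic equation in \<open>s\<close>; its roots \<open>0\<close> and
    \<open>- 1\<close> are the points \<open>a\<close> and \<open>b\<close>.\<close>
  have "s * (s + 1) * ((b - a) \<bullet> (b - a)) = 0"
    using eqs unfolding c inner_real2 by (simp add: algebra_simps) algebra
  then have "s = 0 \<or> s = - 1" using assms(3) by auto
  then show False using c assms(4,5) by auto
qed

section \<open>Normals, area and corner vectors of a dual triangle\<close>

text \<open>Only two unit vectors are orthogonal to the edge, and the side on which \<open>c\<close>
  lies selects one of them. Multiplying by the edge length removes the normalisation.\<close>

lemma outward_normal_triangle:
  assumes "tri a b c \<noteq> 0"
  shows "dist a b *\<^sub>R outward_normal (convex hull {a, b, c}) a b = - sgn (tri a b c) *\<^sub>R rot (b - a)"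
proof -
  have ab: "a \<noteq> b" and nz: "norm (b - a) > 0" using tri_nonzero_distinct[OF assms] by auto
  define n where "n = (- sgn (tri a b c) / norm (b - a)) *\<^sub>R rot (b - a)"
  have "outward_normal (convex hull {a, b, c}) a b = n"
    unfolding outward_normal_def
  proof (rule the_equality, intro conjI ballI)
    show "norm n = 1" using assms nz by (simp add: n_def abs_sgn_eq)
    show n0: "n \<bullet> (b - a) = 0" by (simp add: n_def)
    have "n \<bullet> (c - a) = - \<bar>tri a b c\<bar> / norm (b - a)"
      by (simp add: n_def tri_def[symmetric] abs_sgn mult.commute)
    also have "\<dots> \<le> 0" by (simp add: divide_nonpos_nonneg)
    finally have nc: "n \<bullet> (c - a) \<le> 0" .
    \<comment> \<open>A half-plane is convex, so it is enough to test the three corners.\<close>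
    have "convex hull {a, b, c} \<subseteq> {y. n \<bullet> y \<le> n \<bullet> a}"
      using n0 nc by (intro hull_minimal convex_halfspace_le) (auto simp: inner_diff_right)
    then show "n \<bullet> (y - a) \<le> 0" if "y \<in> convex hull {a, b, c}" for y
      using that by (auto simp: inner_diff_right)
  next
    fix m assume m: "norm m = 1 \<and> m \<bullet> (b - a) = 0 \<and> (\<forall>y\<in>convex hull {a, b, c}. m \<bullet> (y - a) \<le> 0)"
    then obtain s where s: "m = s *\<^sub>R rot (b - a)"
      using orthogonal_eq_scaleR_rot[of "b - a" m] ab by auto
    have "m \<bullet> (c - a) \<le> 0" using m hull_subset[of "{a, b, c}" convex] by auto
    then have st: "s * tri a b c \<le> 0" by (simp add: s tri_def)
    have "\<bar>s\<bar> * norm (b - a) = 1" using m s by simp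
    then have "\<bar>s\<bar> = 1 / norm (b - a)" using nz by (simp add: field_simps)
    moreover have "s = - sgn (tri a b c) * \<bar>s\<bar>"
      using st assms by (cases "s > 0") (auto simp: sgn_if mult_le_0_iff)
    ultimately show "m = n" by (simp add: s n_def)
  qed
  then show ?thesis using nz by (simp add: n_def dist_norm norm_minus_commute)
qed

lemma area_triangle: "area (convex hull {a, b, c}) = \<bar>tri a b c\<bar> / 2"
proof -
  have "area (convex hull {a, b, c}) = measure lborel (convex hull {a, b, c})"
    unfolding area_def
    by (intro measure_completion)
      (simp add: borel_closed compact_imp_closed compact_convex_hull finite_imp_compact)
  also have "\<dots> = \<bar>tri a b c\<bar> / 2"
    unfolding content_triangle by (simp add: tri_def inner_real2 abs_minus_commute algebra_simps)
  finally show ?thesis .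
qed

text \<open>The length-scaled outward normals of a triangle sum to zero, so the halves of the two at
  \<open>a\<close> combine into a vector that depends on the opposite edge and the orientation
  only.\<close>

lemma corner_normal_triangle:
  assumes "p \<in> inodes V" "cells_at V p = {a, b, c}" "tri a b c \<noteq> 0"
  shows "corner_normal V a p = (sgn (tri a b c) / 2) *\<^sub>R rot (c - b)"
proof -
  note d = tri_nonzero_distinct[OF assms(3)]
  have hc: "convex hull {a, c, b} = convex hull {a, b, c}" by (simp add: insert_commute)
  have "tri a c b \<noteq> 0" using assms(3) by (simp add: tri_swap[of a c b])
  note on = outward_normal_triangle[OF this] outward_normal_triangle[OF assms(3)]
  have half: "(x / 2) *\<^sub>R n = (1 / 2) *\<^sub>R (x *\<^sub>R n)" for x and n :: point by simp
  have on: "(dist a b / 2) *\<^sub>R outward_normal (convex hull {a, b, c}) a b = - (sgn (tri a b c) / 2) *\<^sub>R rot (b - a)"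
    "(dist a c / 2) *\<^sub>R outward_normal (convex hull {a, b, c}) a c = (sgn (tri a b c) / 2) *\<^sub>R rot (c - a)"
    by (simp_all only: half[of "dist _ _"] on[unfolded hc] tri_swap[of a c b]) (simp_all add: sgn_minus)
  have "{a, b, c} - {a} = {b, c}" using d by auto
  then show ?thesis
    using d assms(1) unfolding corner_normal_def dual_cell_def assms(2)
    by (simp add: on) (simp add: vec_eq_iff forall_2 field_simps)
qed

text \<open>The inner product is a quarter of \<open>tri a b c\<close> and the area is half of its
  modulus: the shape of the triangle drops out and only its orientation remains.\<close>

lemma corner_tangent_inner_corner_normal:
  assumes "p \<in> inodes V" "cells_at V p = {a, b, c}" "tri a b c \<noteq> 0"
  shows "corner_tangent V a p \<bullet> corner_normal V b p / area (dual_cell V p) = sgn (tri a b c) / 2"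
proof -
  have "cells_at V p = {b, c, a}" "tri b c a \<noteq> 0"
    using assms(2,3) by (auto simp: tri_rotate)
  from corner_normal_triangle[OF assms(1) this]
  have b: "corner_normal V b p = (sgn (tri a b c) / 2) *\<^sub>R rot (a - c)" by (simp add: tri_rotate)
  have "corner_tangent V a p \<bullet> corner_normal V b p = (sgn (tri a b c))\<^sup>2 * tri a b c / 4"
    unfolding corner_tangent_def b corner_normal_triangle[OF assms]
    by (simp add: inner_real2 tri_def[of a b c] power2_eq_square field_simps)
  also have "\<dots> = tri a b c / 4" using assms(3) by (simp add: sgn_if)
  finally show ?thesis
    using assms(3) by (simp add: dual_cell_def assms(2) area_triangle sgn_if)
qed

section \<open>Nodes, regions and edges of the Voronoi diagram\<close>

lemma finite_generators: "is_voronoi_grid V \<Longrightarrow> finite (generators V)"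
  by (simp add: is_voronoi_grid_def)

lemma cells_at_equidistant:
  assumes "a \<in> cells_at V p" "b \<in> cells_at V p"
  shows "dist p a = dist p b"
  using assms by (force simp: cells_at_def cell_def intro: antisym)

text \<open>The three generators at a node lie on a circle about it, hence are not
  collinear.\<close>

lemma node_triangle:
  assumes grid: "is_voronoi_grid V" and p: "p \<in> inodes V"
    and c: "c \<in> cells_at V p" and d: "d \<in> cells_at V p" and "c \<noteq> d"
  obtains e where "cells_at V p = {c, d, e}" "tri c d e \<noteq> 0"
proof -
  have "card (cells_at V p) = 3" using grid p by (simp add: is_voronoi_grid_def)
  then obtain x y z where "cells_at V p = {x, y, z}" "x \<noteq> y" "x \<noteq> z" "y \<noteq> z"
    by (auto simp: card_3_iff)
  with c d \<open>c \<noteq> d\<close> obtain e where e: "cells_at V p = {c, d, e}" "e \<noteq> c" "e \<noteq> d"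
    by (auto simp: insert_commute)
  then have "e \<in> cells_at V p" by simp
  with c d e \<open>c \<noteq> d\<close> have "tri c d e \<noteq> 0"
    by (metis tri_circumcenter_nonzero cells_at_equidistant)
  with e that show thesis by blast
qed

text \<open>The term \<open>y \<bullet> y\<close> cancels from the squared distances, leaving a
  half-space condition on \<open>y\<close>.\<close>

lemma dist_le_iff_inner: "dist y c \<le> dist y d \<longleftrightarrow> (2 *\<^sub>R (d - c)) \<bullet> y \<le> d \<bullet> d - c \<bullet> c"
  for y :: "'a :: real_inner"
proof -
  have "dist y c \<le> dist y d \<longleftrightarrow> (y - c) \<bullet> (y - c) \<le> (y - d) \<bullet> (y - d)"
    by (simp add: dist_norm norm_le)
  then show ?thesis by (simp add: algebra_simps inner_commute)
qed

lemma convex_voronoi_region: "convex {y :: 'a :: real_inner. \<forall>d\<in>S. dist y c \<le> dist y d}"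
proof -
  have "{y. \<forall>d\<in>S. dist y c \<le> dist y d} = (\<Inter>d\<in>S. {y. (2 *\<^sub>R (d - c)) \<bullet> y \<le> d \<bullet> d - c \<bullet> c})"
    by (auto simp: dist_le_iff_inner)
  then show ?thesis by (simp add: convex_INT convex_halfspace_le del: inner_scaleR_left)
qed

text \<open>\<open>cell\<close> is cut off at the closed domain, so the uncut region must be shown
  not to leave it. Being convex, the region is connected and contains \<open>c\<close>; leaving the
  domain, it would meet the frontier, and the cell would then have a boundary node.\<close>

lemma interior_voronoi_region:
  assumes grid: "is_voronoi_grid V" and c: "c \<in> generators V"
    and int: "nodes_of V c \<inter> frontier (domain V) = {}"
  shows "{y. \<forall>d\<in>generators V. dist y c \<le> dist y d} \<subseteq> domain V" (is "?W \<subseteq> _")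
proof (rule ccontr)
  assume "\<not> ?W \<subseteq> domain V"
  moreover have "c \<in> ?W \<inter> domain V" using grid c by (auto simp: is_voronoi_grid_def)
  ultimately have "?W \<inter> frontier (domain V) \<noteq> {}"
    using connected_Int_frontier[OF convex_connected[OF convex_voronoi_region]] by blast
  then have "cell V c \<inter> frontier (domain V) \<noteq> {}"
    by (auto simp: cell_def frontier_def)
  with grid c have "cell V c \<inter> bnodes V \<noteq> {}" "bnodes V \<subseteq> frontier (domain V)"
    by (auto simp: is_voronoi_grid_def)
  with int show False by (auto simp: nodes_of_def)
qed

text \<open>
  Walking from \<open>p\<close> along the Voronoi edge shared by \<open>c\<close> and \<open>d\<close>, the first further generator
  that becomes equally close gives the other end of the edge.
\<close>

lemma opposite_node:
  assumes grid: "is_voronoi_grid V"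
    and region: "{y. \<forall>d\<in>generators V. dist y c \<le> dist y d} \<subseteq> domain V"
    and p: "p \<in> inodes V" "cells_at V p = {c, d, e}" and k: "k * tri c d e > 0"
  obtains q e' where "q \<in> inodes V" "cells_at V q = {c, d, e'}" "k * tri c d e' < 0"
proof -
  let ?G = "generators V"
  \<comment> \<open>\<open>- w\<close> points along the bisector of \<open>c\<close> and
    \<open>d\<close>, away from the side of \<open>e\<close>; the factor \<open>k\<close> covers
    both orientations at once.\<close>
  define w where "w = k *\<^sub>R rot (d - c)"
  \<comment> \<open>The squared distance to \<open>x\<close> minus that to \<open>c\<close>: affine
    in \<open>y\<close>, and nonnegative on the region of \<open>c\<close> for every generator
    \<open>x\<close>.\<close>
  define h where "h x y = (y - x) \<bullet> (y - x) - (y - c) \<bullet> (y - c)" for x y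
  have h_iff: "h x y \<ge> 0 \<longleftrightarrow> dist y c \<le> dist y x" for x y
    by (simp add: h_def dist_norm norm_le)
  have h_line: "h x (p - s *\<^sub>R w) = h x p + 2 * s * (w \<bullet> (x - c))" for x s
    by (simp add: h_def algebra_simps inner_commute)
  have w_tri: "w \<bullet> (x - c) = k * tri c d x" for x by (simp add: w_def tri_def)
  have wd: "w \<bullet> (d - c) = 0" by (simp add: w_def)
  have cd: "c \<in> cells_at V p" "d \<in> cells_at V p" "c \<in> ?G" "d \<in> ?G"
    using p by (auto simp: cells_at_def)
  have hp: "h x p \<ge> 0" if "x \<in> ?G" for x
    using cd that by (simp add: h_iff cells_at_def cell_def)
  have hd: "h d p = 0"
    using cells_at_equidistant[OF cd(1,2)] by (simp add: h_def dist_norm dot_square_norm)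
  \<comment> \<open>The generators approached, relative to \<open>c\<close>, along the walk;
    \<open>r x\<close> is the parameter at which \<open>x\<close> becomes as close as
    \<open>c\<close>.\<close>
  define I where "I = {x \<in> ?G. w \<bullet> (x - c) < 0}"
  define r where "r x = h x p / - (2 * (w \<bullet> (x - c)))" for x
  have "finite I" using finite_generators[OF grid] by (simp add: I_def)
  \<comment> \<open>If no generator were approached, the whole ray would stay in the region of
    \<open>c\<close>, hence in the bounded domain.\<close>
  have "I \<noteq> {}"
  proof
    assume "I = {}"
    then have pos: "w \<bullet> (x - c) \<ge> 0" if "x \<in> ?G" for x using that by (force simp: I_def)
    have ray: "p - s *\<^sub>R w \<in> domain V" if "s \<ge> 0" for s
      using region hp pos that by (auto simp: h_line simp flip: h_iff)
    have "w \<noteq> 0" using k w_tri[of e] by auto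
    obtain B where B: "\<And>y. y \<in> domain V \<Longrightarrow> norm y \<le> B"
      using grid by (auto simp: is_voronoi_grid_def bounded_iff)
    have "p \<in> domain V" using p by (simp add: inodes_def)
    then have "B \<ge> 0" using B norm_ge_zero order_trans by blast
    \<comment> \<open>Far enough for \<open>p - s *\<^sub>R w\<close> to have norm at least
      \<open>B + 1\<close>.\<close>
    define s where "s = (B + norm p + 1) / norm w"
    have "s \<ge> 0" using \<open>B \<ge> 0\<close> by (simp add: s_def)
    have "norm (s *\<^sub>R w) = B + norm p + 1" using \<open>w \<noteq> 0\<close> \<open>B \<ge> 0\<close> by (simp add: s_def)
    then show False
      using B[OF ray[OF \<open>s \<ge> 0\<close>]] norm_triangle_ineq4[of p "p - s *\<^sub>R w"] by simp
  qed
  then obtain e' where e': "e' \<in> I" and min: "\<And>x. x \<in> I \<Longrightarrow> r e' \<le> r x"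
    using \<open>finite I\<close> by (metis arg_min_if_finite(1) arg_min_least)
  define q where "q = p - r e' *\<^sub>R w"
  have e'G: "e' \<in> ?G" and e'w: "w \<bullet> (e' - c) < 0" using e' by (auto simp: I_def)
  have "r e' \<ge> 0" using hp[OF e'G] e'w by (simp add: r_def divide_nonneg_neg)
  \<comment> \<open>Generators in \<open>I\<close> are not overtaken before \<open>r e'\<close>, by
    its minimality; for all others \<open>h\<close> does not decrease along the walk.\<close>
  have hq: "h x q \<ge> 0" if "x \<in> ?G" for x
  proof (cases "x \<in> I")
    case True
    then have "r e' * - (2 * (w \<bullet> (x - c))) \<le> h x p"
      using min[OF True] True unfolding r_def[of x] by (subst (asm) pos_le_divide_eq) (simp_all add: I_def)
    then show ?thesis unfolding q_def h_line by (simp add: algebra_simps)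
  next
    case False
    then show ?thesis using hp[OF that] that \<open>r e' \<ge> 0\<close> by (simp add: q_def h_line I_def)
  qed
  have "h e' q = 0" using e'w unfolding q_def h_line r_def by simp
  moreover have "h d q = 0" by (simp add: q_def h_line hd wd)
  moreover have "h c q = 0" by (simp add: h_def)
  moreover have "q \<in> domain V" using region hq by (auto simp: h_iff)
  moreover have "x \<in> cells_at V q" if "h x q = 0" "x \<in> ?G" "q \<in> domain V" for x
  proof -
    have "dist q x = dist q c" using that by (simp add: h_def dist_norm norm_eq)
    then show ?thesis
      using that hq closure_subset by (auto simp: cells_at_def cell_def h_iff)
  qed
  ultimately have sub: "{c, d, e'} \<subseteq> cells_at V q" using cd e'G by auto
  have "k * tri c d e' < 0" using e'w by (simp add: w_tri)
  then have "tri c d e' \<noteq> 0" by auto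
  then have "card {c, d, e'} = 3" using tri_nonzero_distinct by auto
  have "finite (cells_at V q)" using finite_generators[OF grid] by (simp add: cells_at_def)
  then have "q \<in> inodes V"
    using \<open>card {c, d, e'} = 3\<close> \<open>q \<in> domain V\<close> sub by (metis (mono_tags) card_mono inodes_def mem_Collect_eq)
  \<comment> \<open>Exactly three cells meet at a node of the grid, so there is no fourth one at
    \<open>q\<close>.\<close>
  moreover have "cells_at V q = {c, d, e'}"
    using grid calculation \<open>card {c, d, e'} = 3\<close> sub \<open>finite (cells_at V q)\<close>
    by (metis card_subset_eq is_voronoi_grid_def)
  ultimately show thesis using that \<open>k * tri c d e' < 0\<close> by blast
qed

text \<open>Both nodes lie on the bisector of \<open>c\<close> and \<open>d\<close>. Going from
  \<open>p\<close> to \<open>q\<close> cannot favour \<open>e\<close> over \<open>c\<close>, and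
  going back cannot favour \<open>e'\<close>; with both third corners on the same side, the
  displacement is zero.\<close>

lemma node_unique:
  assumes p: "cells_at V p = {c, d, e}" "k * tri c d e > 0"
    and q: "cells_at V q = {c, d, e'}" "k * tri c d e' > 0"
  shows "p = q"
proof -
  have "c \<noteq> d" using p(2) by (auto simp: tri_def inner_real2)
  have bis: "2 * ((d - c) \<bullet> y) = d \<bullet> d - c \<bullet> c" if "{c, d} \<subseteq> cells_at V y" for y
    using cells_at_equidistant[of c V y d] that dist_le_iff_inner[of y c d] dist_le_iff_inner[of y d c]
    by (auto simp: algebra_simps)
  have "(q - p) \<bullet> (d - c) = 0"
    using bis[of p] bis[of q] p q by (simp add: algebra_simps inner_commute)
  then obtain s where "q - p = s *\<^sub>R rot (d - c)"
    using orthogonal_eq_scaleR_rot[of "d - c" "q - p"] \<open>c \<noteq> d\<close> by auto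
  then have s: "q = p + s *\<^sub>R rot (d - c)" by (simp add: algebra_simps)
  have gap: "(x - c) \<bullet> (y - z) \<le> 0"
    if "c \<in> cells_at V y" "{c, x} \<subseteq> cells_at V z" for x y z
  proof -
    have "dist y c \<le> dist y x" "dist z x \<le> dist z c"
      using that by (auto simp: cells_at_def cell_def)
    then show ?thesis by (auto simp: dist_le_iff_inner algebra_simps)
  qed
  have "s * tri c d e \<le> 0" "s * tri c d e' \<ge> 0"
    using gap[where x = e and y = q and z = p] gap[where x = e' and y = p and z = q] p q by (simp_all add: s tri_def inner_commute)
  with p(2) q(2) have "s = 0"
    by (auto simp: zero_less_mult_iff mult_le_0_iff zero_le_mult_iff)
  with s show ?thesis by simp
qed

section \<open>Cancellation along edges and the curl of a gradient\<close>

text \<open>The nodes shared by \<open>c\<close> and \<open>d\<close> are either absent or the two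
  ends of one Voronoi edge, where the terms are \<open>1 / 2\<close> and
  \<open>- 1 / 2\<close>.\<close>

lemma edge_sum_zero:
  assumes grid: "is_voronoi_grid V" and c: "c \<in> generators V" and "c \<noteq> d"
    and int: "nodes_of V c \<inter> frontier (domain V) = {}"
  shows "(\<Sum>p\<in>{p \<in> nodes_of V c. d \<in> cells_at V p}.
            corner_tangent V c p \<bullet> corner_normal V d p / area (dual_cell V p)) = 0"
    (is "sum ?F ?N = 0")
proof (cases "?N = {}")
  case False
  have bnodes: "bnodes V \<subseteq> frontier (domain V)" using grid by (simp add: is_voronoi_grid_def)
  \<comment> \<open>Boundary nodes lie on the frontier, so \<open>int\<close> leaves only interior
    nodes.\<close>
  have N: "?N = {p \<in> inodes V. c \<in> cells_at V p \<and> d \<in> cells_at V p}"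
    using c int bnodes by (auto simp: nodes_of_def cells_at_def)
  obtain p where p: "p \<in> ?N" using False by blast
  then obtain e where e: "cells_at V p = {c, d, e}" "tri c d e \<noteq> 0"
    using node_triangle[OF grid _ _ _ \<open>c \<noteq> d\<close>] N by blast
  define k where "k = sgn (tri c d e)"
  have k: "k * tri c d e > 0" "k \<noteq> 0" using e(2) by (auto simp: k_def sgn_if)
  obtain q e' where q: "q \<in> inodes V" "cells_at V q = {c, d, e'}" "k * tri c d e' < 0"
    using opposite_node[OF grid interior_voronoi_region[OF grid c int] _ e(1) k(1)] p N by blast
  have "?N = {p, q}"
  proof
    show "{p, q} \<subseteq> ?N" unfolding N using p q N by auto
    show "?N \<subseteq> {p, q}"
    proof
      fix r assume "r \<in> ?N"
      then obtain x where x: "cells_at V r = {c, d, x}" "tri c d x \<noteq> 0"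
        using node_triangle[OF grid _ _ _ \<open>c \<noteq> d\<close>] N by blast
      show "r \<in> {p, q}"
      proof (cases "k * tri c d x > 0")
        case True
        then show ?thesis using node_unique[OF x(1) _ e(1) k(1)] by simp
      next
        case False
        \<comment> \<open>Reversing the sign of \<open>k\<close> lets uniqueness apply on the side
          of \<open>q\<close> too.\<close>
        then have "- k * tri c d x > 0" using x(2) k(2) by (simp add: less_le)
        then show ?thesis using node_unique[OF x(1) _ q(2), of "- k"] q(3) by simp
      qed
    qed
  qed
  moreover have "p \<noteq> q"
    using e q k tri_nonzero_distinct[OF e(2)] by (auto simp: doubleton_eq_iff insert_eq_iff)
  moreover have "?F p = sgn (tri c d e) / 2"
    using corner_tangent_inner_corner_normal[OF _ e] p N by simp
  moreover have "?F q = sgn (tri c d e') / 2"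
    using corner_tangent_inner_corner_normal[OF q(1,2)] q(3) by (cases "tri c d e' = 0") simp_all
  moreover have "sgn (tri c d e') = - sgn (tri c d e)"
    using q(3) k(1) by (auto simp: k_def sgn_if split: if_splits)
  ultimately show ?thesis by simp
next
  case True
  show ?thesis unfolding True by simp
qed

text \<open>Exchanging the sums collects, for each generator \<open>d\<close>, the coefficient of
  \<open>\<phi> d\<close>, which is the edge sum of \<open>c\<close> and \<open>d\<close>.\<close>

lemma dcurl_dgrad:
  assumes grid: "is_voronoi_grid V" and c: "c \<in> generators V"
    and int: "nodes_of V c \<inter> frontier (domain V) = {}"
  shows "dcurl V (dgrad V \<phi>) c = 0"
proof (cases "finite (nodes_of V c)")
  case True
  let ?F = "\<lambda>p d. corner_tangent V c p \<bullet> corner_normal V d p / area (dual_cell V p)"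
  have "(\<Sum>p\<in>nodes_of V c. corner_tangent V c p \<bullet> dgrad V \<phi> p)
      = (\<Sum>p\<in>nodes_of V c. \<Sum>d\<in>cells_at V p. \<phi> d * ?F p d)"
    by (simp add: dgrad_def inner_sum_right sum_distrib_left sum_divide_distrib)
  also have "\<dots> = (\<Sum>p\<in>nodes_of V c. \<Sum>d | d \<in> generators V \<and> d \<in> cells_at V p. \<phi> d * ?F p d)"
    by (intro sum.cong) (auto simp: cells_at_def)
  also have "\<dots> = (\<Sum>d\<in>generators V. \<Sum>p | p \<in> nodes_of V c \<and> d \<in> cells_at V p. \<phi> d * ?F p d)"
    by (intro sum.swap_restrict True finite_generators[OF grid])
  also have "\<dots> = 0"
  proof (rule sum.neutral, rule ballI)
    fix d assume "d \<in> generators V"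
    show "(\<Sum>p | p \<in> nodes_of V c \<and> d \<in> cells_at V p. \<phi> d * ?F p d) = 0"
    proof (cases "c = d")
      case True
      \<comment> \<open>The tangent at a corner is the quarter turn of its own normal.\<close>
      then show ?thesis by (simp add: corner_tangent_def)
    next
      case False
      then show ?thesis using edge_sum_zero[OF grid c False int]
        by (simp add: sum_distrib_left[symmetric] del: times_divide_eq_right)
    qed
  qed
  finally show ?thesis by (simp add: dcurl_def)
qed (simp add: dcurl_def) \<comment> \<open>sums over infinite sets are \<open>0\<close>\<close>

section \<open>Uniqueness of the zero solution by a Gronwall argument\<close>

lemma zero_on_has_derivative:
  fixes f :: "real \<Rightarrow> real"
  assumes "\<And>s. s \<in> S \<Longrightarrow> f s = 0" "t \<in> S"
  shows "(f has_real_derivative 0) (at t within S)"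
  using assms by (intro has_field_derivative_transform_within[OF DERIV_const[of 0], of 1]) auto

text \<open>The sum of squares \<open>E\<close> is differentiable and satisfies
  \<open>E' \<le> K E\<close>, so \<open>exp (- K * t) * E t\<close> cannot grow from its initial
  value zero.\<close>

lemma gronwall_system_zero:
  fixes X D :: "'i \<Rightarrow> real \<Rightarrow> real"
  assumes "finite I" "M \<ge> 0"
    and der: "\<And>i t. i \<in> I \<Longrightarrow> t \<in> {0..T} \<Longrightarrow> (X i has_real_derivative D i t) (at t within {0..T})"
    and bound: "\<And>i t. i \<in> I \<Longrightarrow> t \<in> {0..T} \<Longrightarrow> \<bar>D i t\<bar> \<le> M * (\<Sum>k\<in>I. \<bar>X k t\<bar>)"
    and init: "\<And>i. i \<in> I \<Longrightarrow> X i 0 = 0"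
    and i: "i \<in> I" and t: "t \<in> {0..T}"
  shows "X i t = 0"
proof -
  define E where "E t = (\<Sum>i\<in>I. (X i t)\<^sup>2)" for t
  \<comment> \<open>The factor \<open>card I\<close> comes from Cauchy-Schwarz, bounding the squared
    sum of moduli by \<open>card I\<close> times \<open>E\<close>.\<close>
  define K where "K = 2 * M * card I"
  define g where "g t = exp (- K * t) * E t" for t
  define g' where "g' t = exp (- K * t) * ((\<Sum>i\<in>I. 2 * X i t * D i t) - K * E t)" for t
  have g: "(g has_real_derivative g' s) (at s within {0..t})" if "s \<in> {0..t}" for s
  proof -
    have "(X i has_real_derivative D i s) (at s within {0..t})" if "i \<in> I" for i
      using der[OF that, of s] \<open>s \<in> {0..t}\<close> t by (auto intro: DERIV_subset)
    then have "(E has_real_derivative (\<Sum>i\<in>I. 2 * X i s * D i s)) (at s within {0..t})"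
      unfolding E_def by (auto intro!: derivative_eq_intros sum.cong)
    then show ?thesis
      unfolding g_def g'_def by (auto intro!: derivative_eq_intros simp: algebra_simps)
  qed
  have g'_le: "g' s \<le> 0" if "s \<in> {0..t}" for s
  proof -
    let ?S = "\<Sum>k\<in>I. \<bar>X k s\<bar>"
    have "(\<Sum>i\<in>I. 2 * X i s * D i s) \<le> (\<Sum>i\<in>I. 2 * \<bar>X i s\<bar> * (M * ?S))"
    proof (rule sum_mono)
      fix i assume "i \<in> I"
      have "X i s * D i s \<le> \<bar>X i s\<bar> * \<bar>D i s\<bar>" by (metis abs_ge_self abs_mult)
      also have "\<dots> \<le> \<bar>X i s\<bar> * (M * ?S)"
        using bound[OF \<open>i \<in> I\<close>] that t by (intro mult_left_mono) auto
      finally show "2 * X i s * D i s \<le> 2 * \<bar>X i s\<bar> * (M * ?S)" by simp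
    qed
    also have "\<dots> = 2 * M * ?S\<^sup>2"
      by (simp add: power2_eq_square sum_distrib_left sum_distrib_right mult_ac)
    also have "\<dots> \<le> 2 * M * (E s * card I)"
      using sum_squared_le_sum_of_squares[of "\<lambda>k. \<bar>X k s\<bar>" I] \<open>M \<ge> 0\<close>
      by (intro mult_left_mono) (auto simp: E_def)
    finally show ?thesis by (simp add: g'_def K_def mult_le_0_iff algebra_simps)
  qed
  obtain s where "s \<in> {0..t}" "g t - g 0 = g' s * (t - 0)"
    using mvt_very_simple[of 0 t g "\<lambda>s. (*) (g' s)"] g t
    by (auto simp: has_field_derivative_def)
  moreover have "g 0 = 0" using init by (simp add: g_def E_def)
  ultimately have "g t \<le> 0" using g'_le t by (simp add: mult_le_0_iff)
  then have "E t \<le> 0" by (simp add: g_def mult_le_0_iff not_le[symmetric])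
  moreover have "E t \<ge> 0" by (simp add: E_def sum_nonneg)
  ultimately have "E t = 0" by simp
  then show ?thesis using \<open>finite I\<close> i by (simp add: E_def sum_nonneg_eq_0_iff)
qed

section \<open>Linearity and bounds of the discrete operators\<close>

lemma dcurl_cong: "(\<And>p. p \<in> nodes_of V c \<Longrightarrow> \<psi> p = \<eta> p) \<Longrightarrow> dcurl V \<psi> c = dcurl V \<eta> c"
  by (simp add: dcurl_def)

lemma dcurl_diff: "dcurl V (\<lambda>p. \<psi> p - \<eta> p) c = dcurl V \<psi> c - dcurl V \<eta> c"
  by (simp add: dcurl_def inner_diff_right sum_subtractf right_diff_distrib diff_divide_distrib)

lemma dcurl_minus: "dcurl V (\<lambda>p. - \<psi> p) c = - dcurl V \<psi> c"
  by (simp add: dcurl_def sum_negf)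

lemma dcurl_has_derivative:
  assumes "\<And>p. p \<in> nodes_of V c \<Longrightarrow> ((\<lambda>s. j s p) has_vector_derivative \<psi> p) F"
  shows "((\<lambda>s. dcurl V (j s) c) has_real_derivative dcurl V \<psi> c) F"
  unfolding dcurl_def has_real_derivative_iff_has_vector_derivative
  by (intro has_vector_derivative_mult_right has_vector_derivative_sum
      bounded_linear.has_vector_derivative[OF bounded_linear_inner_right] assms)

text \<open>The factor \<open>S\<close> is pulled out so that the remaining constant involves only
  the grid and \<open>q\<close>; with \<open>S\<close> the sum of the curl moduli this is the bound
  for Gronwall.\<close>

lemma dcurl_abs_le:
  assumes "\<And>p. p \<in> nodes_of V c \<Longrightarrow> norm (\<psi> p) \<le> q p * S"
  shows "\<bar>dcurl V \<psi> c\<bar> \<le> (\<bar>1 / area (cell V c)\<bar> * (\<Sum>p\<in>nodes_of V c. norm (corner_tangent V c p) * q p)) * S"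
proof -
  have "\<bar>\<Sum>p\<in>nodes_of V c. corner_tangent V c p \<bullet> \<psi> p\<bar>
      \<le> (\<Sum>p\<in>nodes_of V c. norm (corner_tangent V c p) * (q p * S))"
  proof (intro order.trans[OF sum_abs] sum_mono)
    fix p assume "p \<in> nodes_of V c"
    show "\<bar>corner_tangent V c p \<bullet> \<psi> p\<bar> \<le> norm (corner_tangent V c p) * (q p * S)"
      using Cauchy_Schwarz_ineq2[of "corner_tangent V c p" "\<psi> p"]
        mult_left_mono[OF assms[OF \<open>p \<in> nodes_of V c\<close>] norm_ge_zero[of "corner_tangent V c p"]]
      by linarith
  qed
  then have "\<bar>1 / area (cell V c)\<bar> * \<bar>\<Sum>p\<in>nodes_of V c. corner_tangent V c p \<bullet> \<psi> p\<bar>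
      \<le> \<bar>1 / area (cell V c)\<bar> * (\<Sum>p\<in>nodes_of V c. norm (corner_tangent V c p) * (q p * S))"
    by (intro mult_left_mono) auto
  then show ?thesis
    unfolding dcurl_def abs_mult abs_minus_cancel by (simp only: sum_distrib_right mult.assoc)
qed

text \<open>The curl-cross-velocity term of the evolution, with the cell curls
  \<open>\<omega>\<close> as an argument to make its linearity in them visible.\<close>

definition coriolis :: "voronoi_grid \<Rightarrow> (point \<Rightarrow> real) \<Rightarrow> (point \<Rightarrow> point) \<Rightarrow> point \<Rightarrow> point" where
  "coriolis V \<omega> v p = (1 / area (dual_cell V p)) *\<^sub>R
     (\<Sum>d\<in>cells_at V p. area (subcell V d p) *\<^sub>R (\<omega> d *\<^sub>R rot (v d)))"

lemma coriolis_norm_le: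
  assumes fin: "finite (generators V)" and B: "\<And>d. d \<in> generators V \<Longrightarrow> norm (v d) \<le> B"
  shows "norm (coriolis V \<omega> v p)
    \<le> (\<bar>1 / area (dual_cell V p)\<bar> * (\<Sum>d\<in>cells_at V p. \<bar>area (subcell V d p)\<bar> * B))
        * (\<Sum>d\<in>generators V. \<bar>\<omega> d\<bar>)"
proof -
  let ?S = "\<Sum>d\<in>generators V. \<bar>\<omega> d\<bar>"
  have "norm (\<Sum>d\<in>cells_at V p. area (subcell V d p) *\<^sub>R (\<omega> d *\<^sub>R rot (v d)))
      \<le> (\<Sum>d\<in>cells_at V p. \<bar>area (subcell V d p)\<bar> * (?S * B))"
  proof (intro order.trans[OF norm_sum] sum_mono)
    fix d assume "d \<in> cells_at V p"
    then have d: "d \<in> generators V" by (simp add: cells_at_def)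
    have "\<bar>\<omega> d\<bar> \<le> ?S" using fin d by (intro member_le_sum) auto
    then have "\<bar>\<omega> d\<bar> * norm (v d) \<le> ?S * B" using B[OF d] by (intro mult_mono) (auto intro: sum_nonneg)
    then show "norm (area (subcell V d p) *\<^sub>R (\<omega> d *\<^sub>R rot (v d))) \<le> \<bar>area (subcell V d p)\<bar> * (?S * B)"
      by (simp add: abs_mult mult.assoc mult_left_mono)
  qed
  then have "norm (coriolis V \<omega> v p)
      \<le> \<bar>1 / area (dual_cell V p)\<bar> * (\<Sum>d\<in>cells_at V p. \<bar>area (subcell V d p)\<bar> * (?S * B))"
    unfolding coriolis_def norm_scaleR by (intro mult_left_mono) auto
  also have "(\<Sum>d\<in>cells_at V p. \<bar>area (subcell V d p)\<bar> * (s * B))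
      = (\<Sum>d\<in>cells_at V p. \<bar>area (subcell V d p)\<bar> * B) * s" for s
    unfolding sum_distrib_right by (simp add: mult_ac)
  finally show ?thesis by (simp only: mult.assoc)
qed

section \<open>Propagation of vanishing cell curls in time\<close>

theorem mainTheorem2:
  fixes V :: voronoi_grid
    and T :: real
    and j :: "real \<Rightarrow> point \<Rightarrow> point"            (* impulse at the nodes *)
    and jc :: "real \<Rightarrow> point \<Rightarrow> point"           (* impulse in the cells *)
    and u :: "real \<Rightarrow> point \<Rightarrow> point"
    and \<theta> :: "real \<Rightarrow> point \<Rightarrow> real"
    and \<phi> :: "real \<Rightarrow> point \<Rightarrow> real"             (* values of j . u + theta in the cells *)
    and un :: "real \<Rightarrow> point \<Rightarrow> point"           (* velocity at the nodes *)
    and \<theta>n :: "real \<Rightarrow> point \<Rightarrow> real"            (* temperature at the nodes *)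
    and \<phi>n :: "real \<Rightarrow> point \<Rightarrow> real"            (* values of j . u + theta at the nodes *)
    and z :: "real \<Rightarrow> point \<Rightarrow> real"
    and \<phi>0 :: "point \<Rightarrow> real"                    (* initial potential *)
  assumes grid: "is_voronoi_grid V"
    and T: "0 < T"
    and u_cont: "\<And>c. c \<in> generators V \<Longrightarrow> continuous_on {0..T} (\<lambda>t. u t c)"
    and speed: "\<And>t p. t \<in> {0..T} \<Longrightarrow> p \<in> inodes V \<union> bnodes V \<Longrightarrow> 0 < z t p"
    and node_value: "\<And>t p. t \<in> {0..T} \<Longrightarrow> p \<in> inodes V \<union> bnodes V \<Longrightarrow>
          \<phi>n t p = j t p \<bullet> un t p + \<theta>n t p"
    and cell_system: "\<And>t c. t \<in> {0..T} \<Longrightarrow> c \<in> generators V \<Longrightarrow>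
          (\<Sum>p\<in>nodes_of V c. corner_matrix V (z t p) c p) *v jc t c =
          (\<Sum>p\<in>nodes_of V c. corner_matrix V (z t p) c p *v j t p + \<phi>n t p *\<^sub>R corner_normal V c p)"
    and cell_value: "\<And>t c. t \<in> {0..T} \<Longrightarrow> c \<in> generators V \<Longrightarrow>
          \<phi> t c = jc t c \<bullet> u t c + \<theta> t c"
    and boundary: "\<And>t c. t \<in> {0..T} \<Longrightarrow> c \<in> generators V \<Longrightarrow>
          nodes_of V c \<inter> frontier (domain V) \<noteq> {} \<Longrightarrow> dcurl V (j t) c = 0"
    and evolution: "\<And>t p. t \<in> {0..T} \<Longrightarrow> p \<in> inodes V \<Longrightarrow>
          ((\<lambda>s. j s p) has_vector_derivative
             (- (1 / area (dual_cell V p)) *\<^sub>R (\<Sum>c\<in>cells_at V p. \<phi> t c *\<^sub>R corner_normal V c p)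
              - (1 / area (dual_cell V p)) *\<^sub>R
                  (\<Sum>c\<in>cells_at V p. area (subcell V c p) *\<^sub>R (dcurl V (j t) c *\<^sub>R rot (u t c)))))
          (at t within {0..T})"
    and initial: "\<And>p. p \<in> inodes V \<Longrightarrow> j 0 p = dgrad V \<phi>0 p"
  shows "\<forall>p\<in>inodes V. \<forall>t\<in>{0..T}.
           ((\<lambda>s. dual_dcurl V (j s) p) has_real_derivative 0) (at t within {0..T})"
proof -
  let ?G = "generators V"
  define interior_cell where "interior_cell c \<longleftrightarrow> nodes_of V c \<inter> frontier (domain V) = {}" for c
  have interior_nodes: "nodes_of V c \<subseteq> inodes V" if "interior_cell c" for c
    using grid that by (auto simp: interior_cell_def nodes_of_def is_voronoi_grid_def)
  have fin: "finite ?G" by (rule finite_generators[OF grid])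
  \<comment> \<open>Finitely many continuous velocities on a compact interval have a common bound,
    which makes the coefficients of the curl system bounded.\<close>
  have "bounded (\<Union>c\<in>?G. (\<lambda>t. u t c) ` {0..T})"
    using fin u_cont by (intro bounded_UN ballI compact_imp_bounded compact_continuous_image) auto
  then obtain B where B: "B > 0" "\<And>t c. t \<in> {0..T} \<Longrightarrow> c \<in> ?G \<Longrightarrow> norm (u t c) \<le> B"
    by (force simp: bounded_pos)
  define X where "X c t = dcurl V (j t) c" for c t
  define Q where "Q t = coriolis V (\<lambda>d. X d t) (u t)" for t
  \<comment> \<open>The rate of change of \<open>X c\<close>: the gradient part of the evolution has
    no curl on an interior cell, and the boundary convention keeps the curl of other cells at
    zero.\<close>
  define D where "D c t = (if interior_cell c then - dcurl V (Q t) c else 0)" for c t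
  define q where "q p = \<bar>1 / area (dual_cell V p)\<bar> * (\<Sum>d\<in>cells_at V p. \<bar>area (subcell V d p)\<bar> * B)" for p
  define m where "m c = \<bar>1 / area (cell V c)\<bar> * (\<Sum>p\<in>nodes_of V c. norm (corner_tangent V c p) * q p)" for c
  have m: "m c \<ge> 0" for c
    using B(1) by (auto simp: m_def q_def intro!: mult_nonneg_nonneg sum_nonneg)
  have curl_zero: "X c t = 0" if "c \<in> ?G" "t \<in> {0..T}" for c t
  proof (rule gronwall_system_zero[where I = ?G and X = X and D = D and M = "sum m ?G"])
    fix c t assume c: "c \<in> ?G" and t: "t \<in> {0..T}"
    show "(X c has_real_derivative D c t) (at t within {0..T})"
    proof (cases "interior_cell c")
      case True
      have "((\<lambda>s. j s p) has_vector_derivative - dgrad V (\<phi> t) p - Q t p) (at t within {0..T})"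
        if "p \<in> nodes_of V c" for p
        using evolution[OF t, of p] interior_nodes[OF True] that
        by (auto simp: dgrad_def Q_def coriolis_def X_def)
      then have "(X c has_real_derivative dcurl V (\<lambda>p. - dgrad V (\<phi> t) p - Q t p) c) (at t within {0..T})"
        unfolding X_def by (rule dcurl_has_derivative)
      moreover have "dcurl V (\<lambda>p. - dgrad V (\<phi> t) p - Q t p) c = D c t"
        using dcurl_dgrad[OF grid c] True by (simp add: dcurl_diff dcurl_minus D_def interior_cell_def)
      ultimately show ?thesis by simp
    next
      case False
      then have "X c s = 0" if "s \<in> {0..T}" for s
        using boundary[OF that c] by (simp add: X_def interior_cell_def)
      then show ?thesis using zero_on_has_derivative[OF _ t, of "X c"] False by (simp add: D_def)
    qed
    have "\<bar>dcurl V (Q t) c\<bar> \<le> m c * (\<Sum>d\<in>?G. \<bar>X d t\<bar>)"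
      unfolding m_def Q_def q_def by (intro dcurl_abs_le coriolis_norm_le fin B(2) t)
    \<comment> \<open>Replacing \<open>m c\<close> by the sum over all cells gives one constant for
      the system.\<close>
    also have "\<dots> \<le> sum m ?G * (\<Sum>d\<in>?G. \<bar>X d t\<bar>)"
      using c fin m by (intro mult_right_mono member_le_sum sum_nonneg) auto
    finally show "\<bar>D c t\<bar> \<le> sum m ?G * (\<Sum>d\<in>?G. \<bar>X d t\<bar>)"
      using m by (auto simp: D_def intro!: mult_nonneg_nonneg sum_nonneg)
  next
    fix c assume c: "c \<in> ?G"
    show "X c 0 = 0"
    proof (cases "interior_cell c")
      case True
      then have "X c 0 = dcurl V (dgrad V \<phi>0) c"
        unfolding X_def using interior_nodes initial by (intro dcurl_cong) auto
      then show ?thesis using dcurl_dgrad[OF grid c] True by (simp add: interior_cell_def)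
    next
      case False
      then show ?thesis using boundary[of 0 c] c T by (simp add: X_def interior_cell_def)
    qed
  qed (use that fin m in \<open>auto intro: sum_nonneg\<close>)
  \<comment> \<open>The dual curl is a weighted sum of cell curls, hence itself zero throughout the
    time interval.\<close>
  have dual: "dual_dcurl V (j s) p = 0" if "s \<in> {0..T}" for s p
    using curl_zero that by (auto simp: dual_dcurl_def X_def cells_at_def intro!: sum.neutral)
  show ?thesis
    by (intro ballI zero_on_has_derivative dual)
qed

end
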